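(* Let $G$ be an abelian-by-cyclic group, i.e. a group having an abelian normal subgroup $A$ such that $G/A$ is cyclic (no finiteness is assumed). Then $B_0(G)=0$.
   Context: For a group $G$, $M(G)=H_2(G,\mathbb Z)$, and $M_0(G)\le M(G)$ is the sum of the images of all maps $H_2(B,\mathbb Z)\to H_2(G,\mathbb Z)$ induced by inclusion, as $B$ runs through all abelian subgroups of $G$; equivalently, $M_0(G)$ is generated by the classes of the cycles $[x\mid y]-[y\mid x]$ (normalized bar complex) for commuting $x,y\in G$. The Bogomolov multiplier is $B_0(G)=M(G)/M_0(G)$. *)

theory Defs
  imports "HOL-Algebra.Elementary_Groups" "HOL-Algebra.Free_Abelian_Groups"
begin

section \<open>Integral group homology via the normalized bar complex\<close>

text \<open>
  The cell \<open>[g\<^sub>1|...|g\<^sub>n]\<close> is encoded as the list \<open>[g\<^sub>1, ..., g\<^sub>n]\<close>. The normalized bar complex with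
  trivial integer coefficients is the quotient of the bar complex by the cells containing the
  identity, so it is free on the lists avoiding \<open>\<one>\<close>, and every other list is read as \<open>0\<close>.
\<close>

type_synonym 'a bar_chain = "'a list \<Rightarrow>\<^sub>0 int"

definition bar_chain_group :: "('a, 'b) monoid_scheme \<Rightarrow> nat \<Rightarrow> 'a bar_chain monoid" where
  "bar_chain_group G n =
     free_Abelian_group {xs. length xs = n \<and> set xs \<subseteq> carrier G - {\<one>\<^bsub>G\<^esub>}}"

definition bar_cell :: "('a, 'b) monoid_scheme \<Rightarrow> 'a list \<Rightarrow> 'a bar_chain" where
  "bar_cell G xs = (if \<one>\<^bsub>G\<^esub> \<in> set xs then 0 else frag_of xs)"

definition bar_face :: "('a, 'b) monoid_scheme \<Rightarrow> nat \<Rightarrow> 'a list \<Rightarrow> 'a list" where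
  "bar_face G i xs =
     (if i = 0 then tl xs
      else if i = length xs then butlast xs
      else take (i - 1) xs @ [xs ! (i - 1) \<otimes>\<^bsub>G\<^esub> xs ! i] @ drop (i + 1) xs)"

definition bar_boundary :: "('a, 'b) monoid_scheme \<Rightarrow> 'a bar_chain \<Rightarrow> 'a bar_chain" where
  "bar_boundary G =
     frag_extend (\<lambda>xs. if xs = [] then 0
       else \<Sum>i\<le>length xs. frag_cmul ((- 1) ^ i) (bar_cell G (bar_face G i xs)))"

text \<open>
  For \<open>n = 0\<close> the target below is \<open>bar_chain_group G 0\<close> instead of the zero group; this is harmless
  because the boundary vanishes in degree \<open>0\<close>.
\<close>

definition bar_cycles :: "('a, 'b) monoid_scheme \<Rightarrow> nat \<Rightarrow> 'a bar_chain set" where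
  "bar_cycles G n =
     kernel (bar_chain_group G n) (bar_chain_group G (n - 1)) (bar_boundary G)"

definition bar_boundaries :: "('a, 'b) monoid_scheme \<Rightarrow> nat \<Rightarrow> 'a bar_chain set" where
  "bar_boundaries G n = bar_boundary G ` carrier (bar_chain_group G (Suc n))"

definition group_homology :: "nat \<Rightarrow> ('a, 'b) monoid_scheme \<Rightarrow> 'a bar_chain set monoid" where
  "group_homology n G =
     (bar_chain_group G n)\<lparr>carrier := bar_cycles G n\<rparr> Mod bar_boundaries G n"

definition bar_chain_map ::
  "('c, 'd) monoid_scheme \<Rightarrow> ('a \<Rightarrow> 'c) \<Rightarrow> 'a bar_chain \<Rightarrow> 'c bar_chain" where
  "bar_chain_map H f = frag_extend (\<lambda>xs. bar_cell H (map f xs))"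

text \<open>
  The homology class \<open>z + B\<^sub>n(G)\<close> is sent to the class \<open>f\<^sub>#(z) + B\<^sub>n(H)\<close>, written without choosing the
  representative \<open>z\<close>: all chains \<open>f\<^sub>#(z')\<close> with \<open>z'\<close> in the given class differ by elements of \<open>B\<^sub>n(H)\<close>.
\<close>

definition group_homology_map ::
  "nat \<Rightarrow> ('c, 'd) monoid_scheme \<Rightarrow> ('a \<Rightarrow> 'c) \<Rightarrow> 'a bar_chain set \<Rightarrow> 'c bar_chain set" where
  "group_homology_map n H f c =
     bar_boundaries H n <#>\<^bsub>bar_chain_group H n\<^esub> (bar_chain_map H f ` c)"

section \<open>The Bogomolov multiplier\<close>

definition schur_multiplier :: "('a, 'b) monoid_scheme \<Rightarrow> 'a bar_chain set monoid" where
  "schur_multiplier G = group_homology 2 G"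

definition schur_multiplier0 :: "('a, 'b) monoid_scheme \<Rightarrow> 'a bar_chain set set" where
  "schur_multiplier0 G =
     generate (schur_multiplier G)
       (\<Union>B \<in> {B. subgroup B G \<and> comm_group (G\<lparr>carrier := B\<rparr>)}.
          group_homology_map 2 G (\<lambda>x. x) ` carrier (group_homology 2 (G\<lparr>carrier := B\<rparr>)))"

definition bogomolov_multiplier :: "('a, 'b) monoid_scheme \<Rightarrow> 'a bar_chain set set monoid" where
  "bogomolov_multiplier G = schur_multiplier G Mod schur_multiplier0 G"

definition abelian_by_cyclic :: "('a, 'b) monoid_scheme \<Rightarrow> bool" where
  "abelian_by_cyclic G \<longleftrightarrow>
     group G \<and> (\<exists>A. A \<lhd> G \<and> comm_group (G\<lparr>carrier := A\<rparr>) \<and> cyclic_group (G Mod A))"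

end

theory Submission
  imports Defs
begin

text \<open>
  Let \<open>N\<close> be the group of 2-cycles whose class lies in \<open>M\<^sub>0(G)\<close>, and let \<open>U = C\<^sub>2 / N\<close>. Then
  \<open>(x, y) \<mapsto> N + [x|y]\<close> is a normalized 2-cocycle; let \<open>E\<close> be the corresponding central extension of
  \<open>G\<close> by \<open>U\<close>. Since \<open>[x|y] - [y|x] \<in> N\<close> for commuting \<open>x, y\<close>, elements of \<open>E\<close> with commuting images
  in \<open>G\<close> commute. So the preimage \<open>A'\<close> of \<open>A\<close> is abelian, \<open>E\<close> is generated by \<open>A'\<close> and one further
  element \<open>t\<close>, and every element of \<open>[E, E]\<close> is a single commutator \<open>[a, t]\<close> with \<open>a \<in> A'\<close>. If such a
  commutator lies in \<open>U\<close>, then the images of \<open>a\<close> and \<open>t\<close> commute, hence so do \<open>a\<close> and \<open>t\<close>; thus \<open>U \<inter> [E, E] = 1\<close>.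

  On the other hand, the homomorphism \<open>C\<^sub>1 \<rightarrow> E / [E, E]\<close> with \<open>[x] \<mapsto> (0, x)\<close> sends the boundary of a
  2-chain \<open>z\<close> to the class of \<open>(N + z, 1)\<close>. For a cycle \<open>z\<close> this gives \<open>(N + z, 1) \<in> U \<inter> [E, E]\<close>, so
  \<open>z \<in> N\<close>.
\<close>

section \<open>Commutators in abelian-by-cyclic groups\<close>

lemma (in group) inv_mult_cancel:
  assumes "x \<in> carrier G" "z \<in> carrier G"
  shows "x \<otimes> (inv x \<otimes> z) = z" "inv x \<otimes> (x \<otimes> z) = z"
  using assms by (simp_all flip: m_assoc)

lemma (in group) commutator_eq_one_iff:
  assumes "x \<in> carrier G" "y \<in> carrier G"
  shows "x \<otimes> y \<otimes> inv x \<otimes> inv y = \<one> \<longleftrightarrow> x \<otimes> y = y \<otimes> x"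
proof -
  have "x \<otimes> y \<otimes> inv x \<otimes> inv y = x \<otimes> y \<otimes> inv (y \<otimes> x)"
    using assms by (simp add: inv_mult_group m_assoc)
  then show ?thesis
    using assms by (simp add: inv_solve_right')
qed

text \<open>Since \<open>A\<close> is abelian and normal, \<open>a\<close> \<mapsto>
  \<open>[a, t]\<close> is an endomorphism of \<open>A\<close>, so its image is a subgroup.
  Commutators of arbitrary elements reduce to commutators of elements of \<open>A\<close> with
  powers of \<open>t\<close>, and these all lie in that image.\<close>

lemma (in group) derived_abelian_by_cyclic:
  assumes A: "A \<lhd> G"
    and comm: "\<And>a b. a \<in> A \<Longrightarrow> b \<in> A \<Longrightarrow> a \<otimes> b = b \<otimes> a"
    and t: "t \<in> carrier G"
    and split: "\<And>g. g \<in> carrier G \<Longrightarrow> \<exists>a\<in>A. \<exists>n::int. g = a \<otimes> t [^] n"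
    and x: "x \<in> derived G (carrier G)"
  shows "\<exists>a\<in>A. x = a \<otimes> t \<otimes> inv a \<otimes> inv t"
proof -
  interpret A: normal A G by (fact A)
  define k where "k a y = a \<otimes> y \<otimes> inv a \<otimes> inv y" for a y
  have Ac [simp]: "a \<in> carrier G" if "a \<in> A" for a
    using that A.subset by blast
  have conj: "y \<otimes> (a \<otimes> inv y) \<in> A" if "a \<in> A" "y \<in> carrier G" for a y
    using A.inv_op_closed2[OF that(2,1)] that by (simp add: m_assoc)
  have kA: "k a y \<in> A" if "a \<in> A" "y \<in> carrier G" for a y
    using conj[of "inv a" y] that by (simp add: k_def m_assoc)
  \<comment> \<open>Expanding gives \<open>a\<close> times \<open>[b, y]\<close> times the conjugate
    of \<open>inv a\<close> by \<open>y\<close>; the last two factors lie in \<open>A\<close> by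
    normality and can be exchanged.\<close>
  have k_mult: "k (a \<otimes> b) y = k a y \<otimes> k b y" if "a \<in> A" "b \<in> A" "y \<in> carrier G" for a b y
  proof -
    have "k (a \<otimes> b) y = a \<otimes> ((b \<otimes> (y \<otimes> (inv b \<otimes> inv y))) \<otimes> (y \<otimes> (inv a \<otimes> inv y)))"
      using that by (simp add: k_def m_assoc inv_mult_group inv_mult_cancel)
    also have "\<dots> = a \<otimes> ((y \<otimes> (inv a \<otimes> inv y)) \<otimes> (b \<otimes> (y \<otimes> (inv b \<otimes> inv y))))"
      using that by (subst comm[of "b \<otimes> (y \<otimes> (inv b \<otimes> inv y))"]) (simp_all add: conj)
    finally show ?thesis
      using that by (simp add: k_def m_assoc)
  qed
  let ?D = "(\<lambda>a. k a t) ` A"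
  have D: "subgroup ?D G"
  proof
    show "?D \<subseteq> carrier G" using kA t by force
    show "\<one> \<in> ?D" using t by (force simp: k_def image_iff intro: bexI[of _ \<one>])
    show "u \<otimes> v \<in> ?D" if "u \<in> ?D" "v \<in> ?D" for u v
      using that t by (auto simp flip: k_mult)
    show "inv u \<in> ?D" if u: "u \<in> ?D" for u
    proof -
      obtain a where a: "a \<in> A" "u = k a t" using u by auto
      have "k (inv a) t \<otimes> k a t = \<one>"
        using k_mult[of "inv a" a t] a t by (simp add: k_def)
      then have "inv u = k (inv a) t"
        using a t kA by (intro inv_equality) auto
      then show ?thesis using a by blast
    qed
  qed
  have k_nat: "k a (t [^] (n::nat)) \<in> ?D" if "a \<in> A" for a n
    using that
  proof (induction n arbitrary: a)
    case 0
    then show ?case using subgroup.one_closed[OF D] by (simp add: k_def)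
  next
    case (Suc n)
    have "t \<otimes> t [^] n = t [^] n \<otimes> t"
      using nat_pow_Suc2[OF t, of n] by simp
    then have pow_t: "z \<in> carrier G \<Longrightarrow> t \<otimes> (t [^] n \<otimes> z) = t [^] n \<otimes> (t \<otimes> z)"
      "inv (t [^] n) \<otimes> inv t = inv t \<otimes> inv (t [^] n)" for z
      using t by (simp_all flip: m_assoc inv_mult_group)
    \<comment> \<open>The identity \<open>[a, t^(n+1)] = [a, t] [t a t^-1, t^n]\<close> changes the
      first entry to a conjugate, so the induction has to range over all \<open>a\<close>.\<close>
    have "k a (t [^] Suc n) = k a t \<otimes> k (t \<otimes> (a \<otimes> inv t)) (t [^] n)"
      using Suc.prems t by (simp add: k_def m_assoc inv_mult_group inv_mult_cancel pow_t)
    then show ?case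
      using Suc t conj by (auto intro!: subgroup.m_closed[OF D])
  qed
  have k_int: "k a (t [^] (n::int)) \<in> ?D" if "a \<in> A" for a n
  proof (cases n rule: int_cases2)
    case (nonneg m)
    then show ?thesis using k_nat[OF that] by (simp add: int_pow_int)
  next
    case (nonpos m)
    define s where "s = t [^] m"
    have s: "s \<in> carrier G" "t [^] n = inv s"
      using t by (auto simp: s_def nonpos int_pow_neg_int)
    \<comment> \<open>This conjugate is chosen so that \<open>[a, s^-1] = [b, s]^-1\<close>, which
      reduces negative powers of \<open>t\<close> to positive ones.\<close>
    define b where "b = inv s \<otimes> (a \<otimes> inv (inv s))"
    have b: "b \<in> A" unfolding b_def using that s by (intro conj) auto
    have "k a (inv s) = inv (k b s)"
      using that s by (simp add: k_def b_def m_assoc inv_mult_group inv_mult_cancel)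
    then show ?thesis
      using k_nat[OF b, of m] s subgroup.m_inv_closed[OF D] unfolding s_def by auto
  qed
  have "derived_set G (carrier G) \<subseteq> ?D"
  proof clarify
    fix g h assume gh: "g \<in> carrier G" "h \<in> carrier G"
    obtain a b and m n :: int where ab: "a \<in> A" "b \<in> A" and g: "g = a \<otimes> t [^] m" and h: "h = b \<otimes> t [^] n"
      using split gh by meson
    define x y where "x = t [^] m" and "y = t [^] n"
    have xy: "x \<in> carrier G" "y \<in> carrier G" using t by (auto simp: x_def y_def)
    have "x \<otimes> y = y \<otimes> x"
      using t by (simp add: x_def y_def int_pow_mult[symmetric] add.commute)
    then have comm': "y \<otimes> inv x = inv x \<otimes> y"
      using xy by (metis inv_closed inv_solve_left inv_solve_right m_assoc m_closed)
    have inv_k: "inv (k b x) = (x \<otimes> (b \<otimes> inv x)) \<otimes> inv b"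
      using ab xy by (simp add: k_def m_assoc inv_mult_group)
    \<comment> \<open>The computation proves \<open>[a x, b y] = [a, y] [b, x]^-1\<close> for
      commuting \<open>x\<close>, \<open>y\<close>: first \<open>y\<close> moves past
      \<open>inv x\<close>, then two conjugates lying in \<open>A\<close> are exchanged.\<close>
    have "g \<otimes> h \<otimes> inv g \<otimes> inv h = a \<otimes> (x \<otimes> (b \<otimes> ((y \<otimes> inv x) \<otimes> (inv a \<otimes> (inv y \<otimes> inv b)))))"
      using ab xy by (simp add: g h flip: x_def y_def) (simp add: m_assoc inv_mult_group)
    also have "\<dots> = a \<otimes> ((x \<otimes> (b \<otimes> inv x)) \<otimes> (y \<otimes> (inv a \<otimes> inv y))) \<otimes> inv b"
      using ab xy by (simp add: comm' m_assoc)
    also have "\<dots> = a \<otimes> ((y \<otimes> (inv a \<otimes> inv y)) \<otimes> (x \<otimes> (b \<otimes> inv x))) \<otimes> inv b"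
      using ab xy by (subst comm[of "x \<otimes> (b \<otimes> inv x)"]) (simp_all add: conj)
    also have "\<dots> = k a y \<otimes> inv (k b x)"
      using ab xy by (simp add: inv_k) (simp add: k_def m_assoc)
    finally show "g \<otimes> h \<otimes> inv g \<otimes> inv h \<in> ?D"
      using k_int[OF ab(1), of n] k_int[OF ab(2), of m] subgroup.m_inv_closed[OF D] subgroup.m_closed[OF D]
      unfolding x_def y_def by metis
  qed
  then have "derived G (carrier G) \<subseteq> ?D"
    unfolding derived_def using D by (rule generate_subgroup_incl)
  then show ?thesis using x by (auto simp: k_def)
qed

text \<open>The assumption \<open>lift\<close> acts twice: it makes the preimage of \<open>A\<close>
  abelian, so that \<open>x\<close> is a single commutator \<open>[a, t]\<close>, and it turns the
  triviality of \<open>[p a, p t]\<close> into that of \<open>[a, t]\<close>.\<close>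

lemma commuting_lift_kernel_derived:
  assumes E: "group E" and p: "p \<in> hom E G" and surj: "p ` carrier E = carrier G"
    and lift: "\<And>x y. x \<in> carrier E \<Longrightarrow> y \<in> carrier E \<Longrightarrow>
      p x \<otimes>\<^bsub>G\<^esub> p y = p y \<otimes>\<^bsub>G\<^esub> p x \<Longrightarrow> x \<otimes>\<^bsub>E\<^esub> y = y \<otimes>\<^bsub>E\<^esub> x"
    and G: "abelian_by_cyclic G"
    and x: "x \<in> derived E (carrier E)" "p x = \<one>\<^bsub>G\<^esub>"
  shows "x = \<one>\<^bsub>E\<^esub>"
proof -
  obtain A where "group G" and A: "A \<lhd> G" and ab: "comm_group (G\<lparr>carrier := A\<rparr>)"
    and cyc: "cyclic_group (G Mod A)"
    using G unfolding abelian_by_cyclic_def by blast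
  interpret G: group G by fact
  interpret E: group E by fact
  interpret p: group_hom E G p
    using p by unfold_locales
  interpret A: normal A G by fact
  interpret Q: group "G Mod A" by (rule A.factorgroup_is_group)
  \<comment> \<open>The element \<open>s\<close> represents a generator of the cyclic quotient; its
    lift \<open>t\<close> to \<open>E\<close> generates \<open>E\<close> together with the preimage
    \<open>A'\<close>.\<close>
  obtain s where s: "s \<in> carrier G" and Q: "carrier (G Mod A) = range (\<lambda>n::int. (A #>\<^bsub>G\<^esub> s) [^]\<^bsub>G Mod A\<^esub> n)"
    using cyc unfolding Q.cyclic_group by (auto simp: carrier_FactGroup)
  obtain t where t: "t \<in> carrier E" "p t = s"
    using s surj by (metis imageE)
  define A' where "A' = {a \<in> carrier E. p a \<in> A}"
  have A': "A' \<lhd> E"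
  proof (rule E.normal_invI)
    show "subgroup A' E"
    proof (rule E.subgroupI)
      have "\<one>\<^bsub>E\<^esub> \<in> A'"
        by (simp add: A'_def)
      then show "A' \<noteq> {}" by blast
    qed (simp_all add: A'_def subset_iff)
    show "x \<otimes>\<^bsub>E\<^esub> h \<otimes>\<^bsub>E\<^esub> inv\<^bsub>E\<^esub> x \<in> A'" if "x \<in> carrier E" "h \<in> A'" for x h
      using that by (auto simp: A'_def A.inv_op_closed2)
  qed
  have comm: "a \<otimes>\<^bsub>E\<^esub> b = b \<otimes>\<^bsub>E\<^esub> a" if "a \<in> A'" "b \<in> A'" for a b
    using that comm_groupE(4)[OF ab] by (intro lift) (auto simp: A'_def)
  have split: "\<exists>a\<in>A'. \<exists>n::int. g = a \<otimes>\<^bsub>E\<^esub> t [^]\<^bsub>E\<^esub> n" if g: "g \<in> carrier E" for g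
  proof -
    have "A #>\<^bsub>G\<^esub> p g \<in> carrier (G Mod A)"
      using g by (simp add: carrier_FactGroup)
    then obtain n :: int where "A #>\<^bsub>G\<^esub> p g = (A #>\<^bsub>G\<^esub> s) [^]\<^bsub>G Mod A\<^esub> n"
      unfolding Q by blast
    also have "\<dots> = A #>\<^bsub>G\<^esub> s [^]\<^bsub>G\<^esub> n"
      using s by (rule A.FactGroup_int_pow)
    \<comment> \<open>Equal cosets only give \<open>p g = a s^n\<close> with some \<open>a\<close>
      in \<open>A\<close>; dividing \<open>g\<close> by \<open>t^n\<close> then produces the factor
      in \<open>A'\<close>.\<close>
    finally have "p g \<in> A #>\<^bsub>G\<^esub> s [^]\<^bsub>G\<^esub> n"
      using g G.rcos_self[OF _ A.subgroup_axioms, of "p g"] by simp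
    then obtain a where a: "a \<in> A" "p g = a \<otimes>\<^bsub>G\<^esub> s [^]\<^bsub>G\<^esub> n"
      by (auto simp: r_coset_def)
    have "p (g \<otimes>\<^bsub>E\<^esub> inv\<^bsub>E\<^esub> (t [^]\<^bsub>E\<^esub> n)) = a"
      using g t s a by (simp add: p.hom_int_pow G.inv_solve_right')
    then have "g \<otimes>\<^bsub>E\<^esub> inv\<^bsub>E\<^esub> (t [^]\<^bsub>E\<^esub> n) \<in> A'"
      using g t a by (simp add: A'_def)
    moreover have "g = g \<otimes>\<^bsub>E\<^esub> inv\<^bsub>E\<^esub> (t [^]\<^bsub>E\<^esub> n) \<otimes>\<^bsub>E\<^esub> t [^]\<^bsub>E\<^esub> n"
      using g t by (simp add: E.m_assoc)
    ultimately show ?thesis by blast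
  qed
  obtain a where a: "a \<in> A'" and xa: "x = a \<otimes>\<^bsub>E\<^esub> t \<otimes>\<^bsub>E\<^esub> inv\<^bsub>E\<^esub> a \<otimes>\<^bsub>E\<^esub> inv\<^bsub>E\<^esub> t"
    using E.derived_abelian_by_cyclic[OF A' comm t(1) split x(1)] by blast
  have aE: "a \<in> carrier E" using a by (simp add: A'_def)
  have "p a \<otimes>\<^bsub>G\<^esub> p t = p t \<otimes>\<^bsub>G\<^esub> p a"
    using x(2) aE t(1) unfolding xa by (simp add: G.commutator_eq_one_iff)
  then have "a \<otimes>\<^bsub>E\<^esub> t = t \<otimes>\<^bsub>E\<^esub> a"
    using aE t by (intro lift) auto
  then show ?thesis
    using E.commutator_eq_one_iff[OF aE t(1)] by (simp only: xa)
qed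

section \<open>Extensions given by a 2-cocycle\<close>

text \<open>For normalized \<open>c\<close>, the section \<open>x\<close> \<mapsto>
  \<open>(1, x)\<close> has factor set \<open>c\<close>, that is,
  \<open>(1, x) (1, y) = (c x y, 1) (1, x y)\<close>. The action of \<open>G\<close> on
  \<open>U\<close> is trivial.\<close>

definition twisted_product ::
  "('u, 'm) monoid_scheme \<Rightarrow> ('a, 'b) monoid_scheme \<Rightarrow> ('a \<Rightarrow> 'a \<Rightarrow> 'u) \<Rightarrow> ('u \<times> 'a) monoid" where
  "twisted_product U G c =
     \<lparr>carrier = carrier U \<times> carrier G,
      mult = (\<lambda>(u, x) (v, y). (u \<otimes>\<^bsub>U\<^esub> v \<otimes>\<^bsub>U\<^esub> c x y, x \<otimes>\<^bsub>G\<^esub> y)),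
      one = (\<one>\<^bsub>U\<^esub>, \<one>\<^bsub>G\<^esub>)\<rparr>"

text \<open>Normalization makes \<open>(1, 1)\<close> the unit of the twisted product and
  \<open>u\<close> \<mapsto> \<open>(u, 1)\<close> multiplicative; the cocycle identity is what
  associativity requires.\<close>

locale normalized_cocycle = U: comm_group U + G: group G
  for U :: "('u, 'm) monoid_scheme" and G :: "('a, 'b) monoid_scheme" +
  fixes c :: "'a \<Rightarrow> 'a \<Rightarrow> 'u"
  assumes closed [simp]: "x \<in> carrier G \<Longrightarrow> y \<in> carrier G \<Longrightarrow> c x y \<in> carrier U"
    and one_left [simp]: "x \<in> carrier G \<Longrightarrow> c \<one>\<^bsub>G\<^esub> x = \<one>\<^bsub>U\<^esub>"
    and one_right [simp]: "x \<in> carrier G \<Longrightarrow> c x \<one>\<^bsub>G\<^esub> = \<one>\<^bsub>U\<^esub>"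
    and cocycle: "\<lbrakk>x \<in> carrier G; y \<in> carrier G; z \<in> carrier G\<rbrakk> \<Longrightarrow>
      c x y \<otimes>\<^bsub>U\<^esub> c (x \<otimes>\<^bsub>G\<^esub> y) z = c y z \<otimes>\<^bsub>U\<^esub> c x (y \<otimes>\<^bsub>G\<^esub> z)"
begin

abbreviation "E \<equiv> twisted_product U G c"

lemma carrier_E [simp]: "carrier E = carrier U \<times> carrier G"
  and one_E [simp]: "\<one>\<^bsub>E\<^esub> = (\<one>\<^bsub>U\<^esub>, \<one>\<^bsub>G\<^esub>)"
  and mult_E [simp]: "(u, x) \<otimes>\<^bsub>E\<^esub> (v, y) = (u \<otimes>\<^bsub>U\<^esub> v \<otimes>\<^bsub>U\<^esub> c x y, x \<otimes>\<^bsub>G\<^esub> y)"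
  by (simp_all add: twisted_product_def)

lemma group_E: "group E"
proof (rule groupI)
  fix a b d assume "a \<in> carrier E" "b \<in> carrier E" "d \<in> carrier E"
  then obtain u x v y w z where eq: "a = (u, x)" "b = (v, y)" "d = (w, z)"
    and [simp]: "u \<in> carrier U" "v \<in> carrier U" "w \<in> carrier U" "x \<in> carrier G" "y \<in> carrier G" "z \<in> carrier G"
    by auto
  have "u \<otimes>\<^bsub>U\<^esub> v \<otimes>\<^bsub>U\<^esub> c x y \<otimes>\<^bsub>U\<^esub> w \<otimes>\<^bsub>U\<^esub> c (x \<otimes>\<^bsub>G\<^esub> y) z
      = u \<otimes>\<^bsub>U\<^esub> v \<otimes>\<^bsub>U\<^esub> w \<otimes>\<^bsub>U\<^esub> (c x y \<otimes>\<^bsub>U\<^esub> c (x \<otimes>\<^bsub>G\<^esub> y) z)"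
    by (simp add: U.m_ac)
  also have "\<dots> = u \<otimes>\<^bsub>U\<^esub> (v \<otimes>\<^bsub>U\<^esub> w \<otimes>\<^bsub>U\<^esub> c y z) \<otimes>\<^bsub>U\<^esub> c x (y \<otimes>\<^bsub>G\<^esub> z)"
    by (subst cocycle) (simp_all add: U.m_ac)
  finally show "a \<otimes>\<^bsub>E\<^esub> b \<otimes>\<^bsub>E\<^esub> d = a \<otimes>\<^bsub>E\<^esub> (b \<otimes>\<^bsub>E\<^esub> d)"
    by (simp add: eq G.m_assoc)
next
  fix a assume "a \<in> carrier E"
  then obtain u x where eq: "a = (u, x)" and [simp]: "u \<in> carrier U" "x \<in> carrier G"
    by auto
  \<comment> \<open>The extra factor cancels the value \<open>c (inv x) x\<close> that the
    multiplication introduces.\<close>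
  have "(inv\<^bsub>U\<^esub> u \<otimes>\<^bsub>U\<^esub> inv\<^bsub>U\<^esub> c (inv\<^bsub>G\<^esub> x) x, inv\<^bsub>G\<^esub> x) \<otimes>\<^bsub>E\<^esub> a = \<one>\<^bsub>E\<^esub>"
    by (simp add: eq) (simp add: U.m_ac U.inv_mult_cancel)
  then show "\<exists>b\<in>carrier E. b \<otimes>\<^bsub>E\<^esub> a = \<one>\<^bsub>E\<^esub>"
    by (intro bexI) auto
qed (auto)

lemma snd_hom_E: "snd \<in> hom E G"
  by (auto intro!: homI)

text \<open>As \<open>U\<close> is abelian, the two products of \<open>(u, x)\<close> and
  \<open>(v, y)\<close> can differ only through \<open>c x y\<close> and \<open>c y x\<close> once
  \<open>x\<close> and \<open>y\<close> commute. Symmetry of \<open>c\<close> on commuting pairs is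
  thus the lifting property of the projection to \<open>G\<close>.\<close>

lemma trivial_of_derived:
  assumes "abelian_by_cyclic G"
    and sym: "\<And>x y. \<lbrakk>x \<in> carrier G; y \<in> carrier G; x \<otimes>\<^bsub>G\<^esub> y = y \<otimes>\<^bsub>G\<^esub> x\<rbrakk> \<Longrightarrow> c x y = c y x"
    and u: "(u, \<one>\<^bsub>G\<^esub>) \<in> derived E (carrier E)"
  shows "u = \<one>\<^bsub>U\<^esub>"
proof -
  have "(u, \<one>\<^bsub>G\<^esub>) = \<one>\<^bsub>E\<^esub>"
  proof (rule commuting_lift_kernel_derived[OF group_E snd_hom_E _ _ assms(1) u])
    show "snd ` carrier E = carrier G" using U.one_closed by force
    show "a \<otimes>\<^bsub>E\<^esub> b = b \<otimes>\<^bsub>E\<^esub> a"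
      if "a \<in> carrier E" "b \<in> carrier E" "snd a \<otimes>\<^bsub>G\<^esub> snd b = snd b \<otimes>\<^bsub>G\<^esub> snd a" for a b
      using that by (cases a; cases b) (auto simp: U.m_comm sym)
  qed simp
  then show ?thesis by simp
qed

end

section \<open>Homomorphisms out of free abelian groups\<close>

lemma hom_free_Abelian_group_eqI:
  assumes f: "f \<in> hom (free_Abelian_group S) H" and g: "g \<in> hom (free_Abelian_group S) H"
    and H: "group H"
    and eq: "\<And>a. a \<in> S \<Longrightarrow> f (frag_of a) = g (frag_of a)"
    and z: "Poly_Mapping.keys z \<subseteq> S"
  shows "f z = g z"
proof -
  interpret f: group_hom "free_Abelian_group S" H f
    using f H by (simp add: group_hom_def group_hom_axioms_def)
  interpret g: group_hom "free_Abelian_group S" H g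
    using g H by (simp add: group_hom_def group_hom_axioms_def)
  show ?thesis
    using z
  proof (rule free_Abelian_group_induct)
    show "f 0 = g 0"
      using f.hom_one g.hom_one by simp
  next
    fix x y
    assume xy: "Poly_Mapping.keys x \<subseteq> S" "Poly_Mapping.keys y \<subseteq> S" "f x = g x" "f y = g y"
    \<comment> \<open>The induction rule proceeds by differences, which are rewritten as products
      with inverses so that the homomorphism laws apply.\<close>
    have "x - y = x \<otimes>\<^bsub>free_Abelian_group S\<^esub> inv\<^bsub>free_Abelian_group S\<^esub> y"
      using xy by simp
    moreover have "x \<in> carrier (free_Abelian_group S)" "y \<in> carrier (free_Abelian_group S)"
      using xy by simp_all
    ultimately show "f (x - y) = g (x - y)"
      using xy by (simp only: f.hom_mult g.hom_mult f.hom_inv g.hom_inv f.G.inv_closed)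
  qed (rule eq)
qed

section \<open>The bar complex in low degrees\<close>

lemma one_bar_chain_group [simp]: "\<one>\<^bsub>bar_chain_group G n\<^esub> = 0"
  and mult_bar_chain_group [simp]: "x \<otimes>\<^bsub>bar_chain_group G n\<^esub> y = x + y"
  by (simp_all add: bar_chain_group_def)

lemma carrier_bar_chain_group:
  "z \<in> carrier (bar_chain_group G n) \<longleftrightarrow>
    Poly_Mapping.keys z \<subseteq> {xs. length xs = n \<and> set xs \<subseteq> carrier G - {\<one>\<^bsub>G\<^esub>}}"
  by (simp add: bar_chain_group_def)

lemma group_bar_chain_group: "group (bar_chain_group G n)"
  by (simp add: bar_chain_group_def)

lemma comm_group_bar_chain_group: "comm_group (bar_chain_group G n)"
  by (simp add: bar_chain_group_def abelian_free_Abelian_group)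

lemma inv_bar_chain_group [simp]:
  "z \<in> carrier (bar_chain_group G n) \<Longrightarrow> inv\<^bsub>bar_chain_group G n\<^esub> z = - z"
  by (simp add: bar_chain_group_def)

lemma diff_bar_chain_group:
  assumes "x \<in> carrier (bar_chain_group G n)" "y \<in> carrier (bar_chain_group G n)"
  shows "x - y \<in> carrier (bar_chain_group G n)"
proof -
  interpret comm_group "bar_chain_group G n" by (rule comm_group_bar_chain_group)
  have "x - y = x \<otimes>\<^bsub>bar_chain_group G n\<^esub> inv\<^bsub>bar_chain_group G n\<^esub> y" using assms by simp
  then show ?thesis using assms by (metis inv_closed m_closed)
qed

lemma bar_cell_in_bar_chain_group:
  "length xs = n \<Longrightarrow> set xs \<subseteq> carrier G \<Longrightarrow> bar_cell G xs \<in> carrier (bar_chain_group G n)"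
  by (auto simp: bar_cell_def carrier_bar_chain_group)

lemma bar_boundary_zero [simp]: "bar_boundary G 0 = 0"
  and bar_boundary_add: "bar_boundary G (x + y) = bar_boundary G x + bar_boundary G y"
  and bar_boundary_diff: "bar_boundary G (x - y) = bar_boundary G x - bar_boundary G y"
  and bar_boundary_minus: "bar_boundary G (- x) = - bar_boundary G x"
  by (simp_all add: bar_boundary_def frag_extend_add frag_extend_diff frag_extend_minus)

lemma bar_cycles_iff:
  "z \<in> bar_cycles G n \<longleftrightarrow> z \<in> carrier (bar_chain_group G n) \<and> bar_boundary G z = 0"
  by (simp add: bar_cycles_def kernel_def)

lemma bar_boundaries_iff:
  "z \<in> bar_boundaries G n \<longleftrightarrow> (\<exists>w\<in>carrier (bar_chain_group G (Suc n)). z = bar_boundary G w)"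
  by (auto simp: bar_boundaries_def)

context group
begin

lemma set_bar_face:
  assumes "set xs \<subseteq> carrier G" "i \<le> length xs"
  shows "set (bar_face G i xs) \<subseteq> carrier G"
proof -
  have "xs ! (i - 1) \<otimes> xs ! i \<in> carrier G" if "i \<noteq> length xs"
    using assms that nth_mem[of "i - 1" xs] nth_mem[of i xs] by (intro m_closed) auto
  then show ?thesis
    using assms
    by (auto simp: bar_face_def dest: in_set_butlastD in_set_takeD in_set_dropD list.set_sel(2)
        split: if_splits)
      (metis list.set_sel(2) subsetD)+
qed

lemma bar_boundary_hom: "bar_boundary G \<in> hom (bar_chain_group G (Suc n)) (bar_chain_group G n)"
proof (rule homI)
  fix z assume z: "z \<in> carrier (bar_chain_group G (Suc n))"
  have *: "bar_boundary G (frag_of xs) \<in> carrier (bar_chain_group G n)"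
    if "length xs = Suc n" "set xs \<subseteq> carrier G" for xs
  proof -
    have "bar_cell G (bar_face G i xs) \<in> carrier (bar_chain_group G n)" if "i \<le> length xs" for i
      using that \<open>length xs = Suc n\<close> set_bar_face[OF \<open>set xs \<subseteq> carrier G\<close> that]
      by (intro bar_cell_in_bar_chain_group) (auto simp: bar_face_def)
    then have "frag_cmul k (bar_cell G (bar_face G i xs)) \<in> carrier (bar_chain_group G n)"
      if "i \<le> length xs" for i k
      using that keys_cmul unfolding carrier_bar_chain_group by blast
    then show ?thesis
      using that unfolding bar_boundary_def bar_chain_group_def
      by (auto simp del: carrier_free_Abelian_group_iff sum.atMost_Suc intro!: sum_closed_free_Abelian_group)
  qed
  show "bar_boundary G z \<in> carrier (bar_chain_group G n)"
    using z[unfolded carrier_bar_chain_group]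
    by (rule free_Abelian_group_induct)
      (auto simp: bar_boundary_diff carrier_bar_chain_group[of 0] intro!: * diff_bar_chain_group)
qed (simp add: bar_boundary_add)

lemma bar_boundary_frag_of_2:
  "bar_boundary G (frag_of [x, y]) = bar_cell G [y] - bar_cell G [x \<otimes> y] + bar_cell G [x]"
  by (simp add: bar_boundary_def bar_face_def)

text \<open>The faces of a nondegenerate 3-cell can be degenerate, so the boundary formula is also
  required when an entry is the identity; there the right-hand side cancels to
  \<open>0\<close>.\<close>

lemma bar_boundary_cell_2:
  assumes "x \<in> carrier G" "y \<in> carrier G"
  shows "bar_boundary G (bar_cell G [x, y]) = bar_cell G [y] - bar_cell G [x \<otimes> y] + bar_cell G [x]"
proof -
  have "bar_cell G [x, y] = frag_of [x, y]" if "x \<noteq> \<one>" "y \<noteq> \<one>"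
    using that[symmetric] by (simp add: bar_cell_def)
  moreover have "bar_cell G [\<one>, y] = 0" "bar_cell G [x, \<one>] = 0" "bar_cell G [\<one>] = 0"
    by (simp_all add: bar_cell_def)
  ultimately show ?thesis
    using assms by (cases "x = \<one>"; cases "y = \<one>") (simp_all add: bar_boundary_frag_of_2)
qed

lemma bar_boundary_frag_of_3:
  "bar_boundary G (frag_of [x, y, z]) =
    bar_cell G [y, z] - bar_cell G [x \<otimes> y, z] + bar_cell G [x, y \<otimes> z] - bar_cell G [x, y]"
  by (simp add: bar_boundary_def bar_face_def numeral_2_eq_2 numeral_3_eq_3)

lemma bar_boundaries_2_subset_cycles: "bar_boundaries G 2 \<subseteq> bar_cycles G 2"
proof
  fix b assume "b \<in> bar_boundaries G 2"
  then obtain w where w: "w \<in> carrier (bar_chain_group G 3)" and b: "b = bar_boundary G w"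
    by (auto simp: bar_boundaries_iff)
  have *: "bar_boundary G (bar_boundary G (frag_of xs)) = 0"
    if "length xs = 3" "set xs \<subseteq> carrier G" for xs
  proof -
    obtain x y z where "xs = [x, y, z]"
      using \<open>length xs = 3\<close> by (auto simp: length_Suc_conv numeral_3_eq_3)
    \<comment> \<open>The terms cancel in pairs once both triple products are bracketed
      alike.\<close>
    then show ?thesis
      using that
      by (simp add: bar_boundary_frag_of_3 bar_boundary_add bar_boundary_diff bar_boundary_cell_2 m_assoc)
  qed
  have "bar_boundary G b = 0"
    unfolding b using w[unfolded carrier_bar_chain_group]
    by (rule free_Abelian_group_induct) (auto simp: bar_boundary_diff intro!: *)
  moreover have "b \<in> carrier (bar_chain_group G 2)"
    unfolding b using hom_in_carrier[OF bar_boundary_hom[of 2]] w by simp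
  ultimately show "b \<in> bar_cycles G 2"
    by (simp add: bar_cycles_iff)
qed

lemma subgroup_bar_cycles: "subgroup (bar_cycles G n) (bar_chain_group G n)"
proof -
  interpret C: comm_group "bar_chain_group G n" by (rule comm_group_bar_chain_group)
  show ?thesis
    using C.m_closed C.inv_closed C.one_closed
    by (intro C.subgroupI) (force simp: bar_cycles_iff bar_boundary_add bar_boundary_minus)+
qed

lemma subgroup_bar_boundaries: "subgroup (bar_boundaries G n) (bar_chain_group G n)"
proof -
  interpret group_hom "bar_chain_group G (Suc n)" "bar_chain_group G n" "bar_boundary G"
    using bar_boundary_hom
    by (simp add: group_hom_def group_hom_axioms_def group_bar_chain_group)
  show ?thesis
    unfolding bar_boundaries_def by (rule img_is_subgroup)
qed

lemma comm_group_group_homology_2: "comm_group (group_homology 2 G)"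
  and group_hom_homology_class_2:
    "group_hom ((bar_chain_group G 2)\<lparr>carrier := bar_cycles G 2\<rparr>) (group_homology 2 G)
      (\<lambda>z. bar_boundaries G 2 #>\<^bsub>bar_chain_group G 2\<^esub> z)"
proof -
  let ?Z = "(bar_chain_group G 2)\<lparr>carrier := bar_cycles G 2\<rparr>"
  interpret C: comm_group "bar_chain_group G 2" by (rule comm_group_bar_chain_group)
  interpret Z: comm_group ?Z
    using C.subgroup_imp_group[OF subgroup_bar_cycles[of 2]] C.m_comm
    by (intro group.group_comm_groupI) (auto simp: add.commute)
  have B: "subgroup (bar_boundaries G 2) ?Z"
    using C.subgroup_incl[OF subgroup_bar_boundaries subgroup_bar_cycles bar_boundaries_2_subset_cycles] .
  show *: "comm_group (group_homology 2 G)"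
    unfolding group_homology_def using Z.abelian_FactGroup[OF B] .
  have "(\<lambda>z. bar_boundaries G 2 #>\<^bsub>?Z\<^esub> z) \<in> hom ?Z (group_homology 2 G)"
    unfolding group_homology_def using B Z.normal_iff_subgroup by (intro normal.r_coset_hom_Mod) blast
  \<comment> \<open>A coset depends only on the multiplication, so cosets formed in the cycle group
    and in the full chain group are the same sets.\<close>
  then show "group_hom ?Z (group_homology 2 G) (\<lambda>z. bar_boundaries G 2 #>\<^bsub>bar_chain_group G 2\<^esub> z)"
    using * by (simp add: group_hom_def group_hom_axioms_def comm_group.axioms(2) r_coset_def)
qed

lemma carrier_group_homology:
  "carrier (group_homology n G) = (\<lambda>z. bar_boundaries G n #>\<^bsub>bar_chain_group G n\<^esub> z) ` bar_cycles G n"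
  by (simp add: group_homology_def carrier_FactGroup r_coset_def)

end

section \<open>Chains of a subgroup inside chains of the group\<close>

lemma bar_boundary_subgroup: "bar_boundary (G\<lparr>carrier := B\<rparr>) = bar_boundary G"
proof -
  \<comment> \<open>Cells and faces use only the unit and the multiplication; passing to a subgroup
    merely restricts the admissible chains.\<close>
  have "bar_cell (G\<lparr>carrier := B\<rparr>) = bar_cell G" "bar_face (G\<lparr>carrier := B\<rparr>) = bar_face G"
    by (simp_all add: fun_eq_iff bar_cell_def bar_face_def)
  then show ?thesis by (simp only: bar_boundary_def)
qed

lemma carrier_bar_chain_group_mono:
  "B \<subseteq> carrier G \<Longrightarrow> carrier (bar_chain_group (G\<lparr>carrier := B\<rparr>) n) \<subseteq> carrier (bar_chain_group G n)"
  unfolding subset_iff carrier_bar_chain_group by auto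

lemma bar_chain_map_id:
  assumes "z \<in> carrier (bar_chain_group (G\<lparr>carrier := B\<rparr>) n)"
  shows "bar_chain_map G (\<lambda>x. x) z = z"
proof -
  have "bar_chain_map G (\<lambda>x. x) z = frag_extend frag_of z"
    unfolding bar_chain_map_def
    using assms by (intro frag_extend_eq) (auto simp: carrier_bar_chain_group bar_cell_def)
  then show ?thesis by (simp flip: frag_expansion)
qed

text \<open>On chains the inclusion is the identity, and boundaries of the subgroup are absorbed by
  those of \<open>G\<close>. So a class coming from a subgroup keeps its representing cycle; the
  reverse inclusion of cosets uses that \<open>0\<close> is a boundary.\<close>

lemma (in group) group_homology_map_inclusion:
  assumes B: "subgroup B G" and z: "z \<in> bar_cycles (G\<lparr>carrier := B\<rparr>) n"
  shows "group_homology_map n G (\<lambda>x. x)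
      (bar_boundaries (G\<lparr>carrier := B\<rparr>) n #>\<^bsub>bar_chain_group (G\<lparr>carrier := B\<rparr>) n\<^esub> z) =
    bar_boundaries G n #>\<^bsub>bar_chain_group G n\<^esub> z"
proof -
  let ?H = "G\<lparr>carrier := B\<rparr>"
  interpret H: group ?H using B by (rule subgroup_imp_group)
  have sub: "bar_boundaries ?H n \<subseteq> carrier (bar_chain_group ?H n)"
    using H.subgroup_bar_boundaries subgroup.subset by blast
  have mono: "bar_boundaries ?H n \<subseteq> bar_boundaries G n"
    using carrier_bar_chain_group_mono[OF subgroup.subset[OF B]]
    by (fastforce simp: bar_boundaries_iff bar_boundary_subgroup)
  have zero: "0 \<in> bar_boundaries ?H n"
    using subgroup.one_closed[OF H.subgroup_bar_boundaries] by simp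
  have zC: "z \<in> carrier (bar_chain_group ?H n)"
    using z by (simp add: bar_cycles_iff)
  have "bar_chain_map G (\<lambda>x. x) (b + z) = b + z" if "b \<in> bar_boundaries ?H n" for b
  proof (rule bar_chain_map_id)
    show "b + z \<in> carrier (bar_chain_group ?H n)"
      using group.subgroup_self[OF group_bar_chain_group, of ?H n] subgroup.m_closed[of _ "bar_chain_group ?H n" b z]
        that sub zC by auto
  qed
  then have img: "bar_chain_map G (\<lambda>x. x) ` (bar_boundaries ?H n #>\<^bsub>bar_chain_group ?H n\<^esub> z) =
      (\<lambda>b. b + z) ` bar_boundaries ?H n"
    by (force simp: r_coset_def)
  have add: "b + b' \<in> bar_boundaries G n" if "b \<in> bar_boundaries G n" "b' \<in> bar_boundaries G n" for b b'
    using subgroup.m_closed[OF subgroup_bar_boundaries that] by simp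
  show ?thesis
    unfolding group_homology_map_def img
  proof
    show "bar_boundaries G n <#>\<^bsub>bar_chain_group G n\<^esub> (\<lambda>b. b + z) ` bar_boundaries ?H n
        \<subseteq> bar_boundaries G n #>\<^bsub>bar_chain_group G n\<^esub> z"
    proof
      fix w assume "w \<in> bar_boundaries G n <#>\<^bsub>bar_chain_group G n\<^esub> (\<lambda>b. b + z) ` bar_boundaries ?H n"
      then obtain b b' where "b \<in> bar_boundaries G n" "b' \<in> bar_boundaries ?H n" "w = (b + b') + z"
        by (auto simp: set_mult_def add.assoc)
      then show "w \<in> bar_boundaries G n #>\<^bsub>bar_chain_group G n\<^esub> z"
        using mono add by (auto simp: r_coset_def)
    qed
    show "bar_boundaries G n #>\<^bsub>bar_chain_group G n\<^esub> z
        \<subseteq> bar_boundaries G n <#>\<^bsub>bar_chain_group G n\<^esub> (\<lambda>b. b + z) ` bar_boundaries ?H n"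
      using zero by (force simp: set_mult_def r_coset_def)
  qed
qed

section \<open>Abelian subgroups through commuting pairs\<close>

lemma (in group) subgroup_centralizer:
  assumes "z \<in> carrier G"
  shows "subgroup {w \<in> carrier G. z \<otimes> w = w \<otimes> z} G"
proof (rule subgroupI)
  show "{w \<in> carrier G. z \<otimes> w = w \<otimes> z} \<noteq> {}"
    using assms one_closed by fastforce
next
  fix h assume "h \<in> {w \<in> carrier G. z \<otimes> w = w \<otimes> z}"
  then have h: "h \<in> carrier G" "z \<otimes> h = h \<otimes> z" by simp_all
  then have "z = inv h \<otimes> z \<otimes> h"
    using assms by (simp add: m_assoc inv_mult_cancel)
  then show "inv h \<in> {w \<in> carrier G. z \<otimes> w = w \<otimes> z}"
    using assms h by (simp add: inv_solve_right')
next
  fix a b assume "a \<in> {w \<in> carrier G. z \<otimes> w = w \<otimes> z}" "b \<in> {w \<in> carrier G. z \<otimes> w = w \<otimes> z}"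
  then have ab: "a \<in> carrier G" "b \<in> carrier G" "z \<otimes> a = a \<otimes> z" "z \<otimes> b = b \<otimes> z" by simp_all
  have "z \<otimes> (a \<otimes> b) = a \<otimes> z \<otimes> b"
    using ab assms by (simp flip: m_assoc)
  also have "\<dots> = a \<otimes> b \<otimes> z"
    using ab assms by (simp add: m_assoc)
  finally show "a \<otimes> b \<in> {w \<in> carrier G. z \<otimes> w = w \<otimes> z}"
    using ab by simp
qed auto

lemma (in group) commuting_pair_in_abelian_subgroup:
  assumes "x \<in> carrier G" "y \<in> carrier G" "x \<otimes> y = y \<otimes> x"
  obtains B where "subgroup B G" "comm_group (G\<lparr>carrier := B\<rparr>)" "x \<in> B" "y \<in> B"
proof -
  let ?B = "generate G {x, y}"
  have sub: "{x, y} \<subseteq> carrier G" using assms by simp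
  have B: "subgroup ?B G" using sub by (rule generate_is_subgroup)
  \<comment> \<open>Centralizers are subgroups, so commuting with both generators suffices. This is
    applied first with \<open>z\<close> equal to \<open>x\<close> or \<open>y\<close>, and then to
    an arbitrary element of the generated subgroup.\<close>
  have commute: "z \<otimes> w = w \<otimes> z"
    if "z \<in> carrier G" "z \<otimes> x = x \<otimes> z" "z \<otimes> y = y \<otimes> z" "w \<in> ?B" for z w
  proof -
    have "{x, y} \<subseteq> {w \<in> carrier G. z \<otimes> w = w \<otimes> z}"
      using that sub by simp
    from generate_subgroup_incl[OF this subgroup_centralizer] that show ?thesis by blast
  qed
  have c: "z \<otimes> w = w \<otimes> z" if z: "z \<in> ?B" and w: "w \<in> ?B" for z w
  proof (rule commute)
    show "z \<in> carrier G" using z subgroup.subset[OF B] by blast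
    show "z \<otimes> x = x \<otimes> z"
      by (rule commute[symmetric]) (simp_all add: assms z)
    show "z \<otimes> y = y \<otimes> z"
      by (rule commute[symmetric]) (simp_all add: assms z)
  qed (rule w)
  show thesis
  proof (rule that[OF B])
    show "comm_group (G\<lparr>carrier := ?B\<rparr>)"
    proof (rule group.group_comm_groupI[OF subgroup_imp_group[OF B]])
      fix z w assume "z \<in> carrier (G\<lparr>carrier := ?B\<rparr>)" "w \<in> carrier (G\<lparr>carrier := ?B\<rparr>)"
      then have "z \<in> ?B" "w \<in> ?B" by simp_all
      then show "z \<otimes>\<^bsub>G\<lparr>carrier := ?B\<rparr>\<^esub> w = w \<otimes>\<^bsub>G\<lparr>carrier := ?B\<rparr>\<^esub> z"
        using c[of z w] by simp
    qed
    show "x \<in> ?B" "y \<in> ?B" by (auto intro: generate.incl)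
  qed
qed

text \<open>The map \<phi> on 1-chains sends \<open>[x]\<close> to the class of
  \<open>(1, x)\<close> in the abelianization of \<open>E\<close>. Its composite with the boundary
  agrees with \<open>z\<close> \<mapsto> class of \<open>(q z, 1)\<close> on 2-cells, hence on all
  2-chains; on cycles the composite is trivial.\<close>

lemma (in normalized_cocycle) cycle_in_derived:
  assumes q: "q \<in> hom (bar_chain_group G 2) U"
    and qc: "\<And>x y. \<lbrakk>x \<in> carrier G; y \<in> carrier G\<rbrakk> \<Longrightarrow> q (bar_cell G [x, y]) = c x y"
    and z: "z \<in> bar_cycles G 2"
  shows "(q z, \<one>\<^bsub>G\<^esub>) \<in> derived E (carrier E)"
proof -
  interpret E: group E by (rule group_E)
  let ?D = "derived E (carrier E)"
  let ?Q = "E Mod ?D"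
  interpret D: normal ?D E by (rule E.derived_self_is_normal)
  interpret Q: comm_group ?Q by (rule E.derived_quot_is_comm_group)
  let ?S = "\<lambda>n. {xs. length xs = n \<and> set xs \<subseteq> carrier G - {\<one>\<^bsub>G\<^esub>}}"
  let ?r = "\<lambda>e. ?D #>\<^bsub>E\<^esub> e"
  interpret r: group_hom E ?Q ?r
    using D.r_coset_hom_Mod by unfold_locales
  have "(\<lambda>xs. ?r (\<one>\<^bsub>U\<^esub>, hd xs)) ` ?S 1 \<subseteq> carrier ?Q"
  proof (rule image_subsetI)
    fix xs assume "xs \<in> ?S 1"
    then have "hd xs \<in> carrier G"
      by (cases xs) auto
    then show "?r (\<one>\<^bsub>U\<^esub>, hd xs) \<in> carrier ?Q"
      by (intro r.hom_closed) simp
  qed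
  then obtain \<phi> where \<phi>: "\<phi> \<in> hom (bar_chain_group G 1) ?Q"
    and \<phi>_of: "\<And>xs. xs \<in> ?S 1 \<Longrightarrow> \<phi> (frag_of xs) = ?r (\<one>\<^bsub>U\<^esub>, hd xs)"
    unfolding bar_chain_group_def by (rule Q.free_Abelian_group_universal) blast
  interpret \<phi>: group_hom "bar_chain_group G 1" ?Q \<phi>
    using \<phi> Q.is_group
    by (simp add: group_hom_def group_hom_axioms_def group_bar_chain_group)
  have \<phi>_zero: "\<phi> 0 = \<one>\<^bsub>?Q\<^esub>"
    using \<phi>.hom_one by simp
  \<comment> \<open>The degenerate cell \<open>[1]\<close> is \<open>0\<close>, and this fits
    because \<open>(1, 1)\<close> is the unit of \<open>E\<close>.\<close>
  have \<phi>_cell: "\<phi> (bar_cell G [x]) = ?r (\<one>\<^bsub>U\<^esub>, x)" if "x \<in> carrier G" for x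
    using that \<phi>_zero r.hom_one by (auto simp: bar_cell_def \<phi>_of)
  have r_mult: "?r ((u, x) \<otimes>\<^bsub>E\<^esub> (v, y)) = ?r (u, x) \<otimes>\<^bsub>?Q\<^esub> ?r (v, y)"
    if "u \<in> carrier U" "x \<in> carrier G" "v \<in> carrier U" "y \<in> carrier G" for u v x y
    using that by (intro r.hom_mult) simp_all
  let ?i = "\<lambda>z. ?r (q z, \<one>\<^bsub>G\<^esub>)"
  have i: "?i \<in> hom (bar_chain_group G 2) ?Q"
  proof (rule homI)
    fix x y assume xy: "x \<in> carrier (bar_chain_group G 2)" "y \<in> carrier (bar_chain_group G 2)"
    then have "q x \<in> carrier U" "q y \<in> carrier U" "q (x + y) = q x \<otimes>\<^bsub>U\<^esub> q y"
      using hom_in_carrier[OF q] hom_mult[OF q xy] by auto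
    then have "(q (x + y), \<one>\<^bsub>G\<^esub>) = (q x, \<one>\<^bsub>G\<^esub>) \<otimes>\<^bsub>E\<^esub> (q y, \<one>\<^bsub>G\<^esub>)"
      by simp
    then show "?i (x \<otimes>\<^bsub>bar_chain_group G 2\<^esub> y) = ?i x \<otimes>\<^bsub>?Q\<^esub> ?i y"
      using \<open>q x \<in> carrier U\<close> \<open>q y \<in> carrier U\<close> by (simp only: mult_bar_chain_group r_mult G.one_closed)
  qed (use hom_in_carrier[OF q] in \<open>auto simp: carrier_FactGroup\<close>)
  have "\<phi> (bar_boundary G z) = ?i z"
  proof (rule hom_free_Abelian_group_eqI[of "\<lambda>z. \<phi> (bar_boundary G z)" "?S 2" ?Q ?i])
    have "bar_boundary G \<in> hom (bar_chain_group G 2) (bar_chain_group G 1)"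
      using G.bar_boundary_hom[of 1] by (simp add: numeral_2_eq_2)
    from hom_compose[OF this \<phi>]
    show "(\<lambda>z. \<phi> (bar_boundary G z)) \<in> hom (free_Abelian_group (?S 2)) ?Q"
      by (simp add: comp_def bar_chain_group_def)
    show "?i \<in> hom (free_Abelian_group (?S 2)) ?Q"
      using i by (simp add: bar_chain_group_def)
    show "Poly_Mapping.keys z \<subseteq> ?S 2"
      using z by (simp add: bar_cycles_iff carrier_bar_chain_group)
  next
    fix xs assume "xs \<in> ?S 2"
    then obtain x y where xs: "xs = [x, y]" and xy: "x \<in> carrier G" "y \<in> carrier G" "x \<noteq> \<one>\<^bsub>G\<^esub>" "y \<noteq> \<one>\<^bsub>G\<^esub>"
      by (auto simp: length_Suc_conv numeral_2_eq_2)
    have of_xs: "frag_of xs = bar_cell G [x, y]"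
      using xy by (simp add: xs bar_cell_def)
    have cells: "bar_cell G [u] \<in> carrier (bar_chain_group G 1)" if "u \<in> carrier G" for u
      using that by (intro bar_cell_in_bar_chain_group) auto
    have bd: "bar_boundary G (frag_of xs) \<in> carrier (bar_chain_group G 1)"
      using hom_in_carrier[OF G.bar_boundary_hom[of 1], of "frag_of xs"] \<open>xs \<in> ?S 2\<close>
      by (simp add: carrier_bar_chain_group numeral_2_eq_2)
    \<comment> \<open>Moving \<open>[x y]\<close> to the left removes the subtraction, so that
      \<phi> can be applied using multiplicativity only; the common factor is cancelled at the
      end.\<close>
    have "bar_boundary G (frag_of xs) \<otimes>\<^bsub>bar_chain_group G 1\<^esub> bar_cell G [x \<otimes>\<^bsub>G\<^esub> y] =
        bar_cell G [x] \<otimes>\<^bsub>bar_chain_group G 1\<^esub> bar_cell G [y]"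
      using xy by (simp add: of_xs G.bar_boundary_cell_2)
    then have "\<phi> (bar_boundary G (frag_of xs)) \<otimes>\<^bsub>?Q\<^esub> ?r (\<one>\<^bsub>U\<^esub>, x \<otimes>\<^bsub>G\<^esub> y) = ?r (\<one>\<^bsub>U\<^esub>, x) \<otimes>\<^bsub>?Q\<^esub> ?r (\<one>\<^bsub>U\<^esub>, y)"
      using xy cells bd
      by (simp only: \<phi>.hom_mult[symmetric] \<phi>_cell[symmetric] G.m_closed)
    also have "\<dots> = ?r ((\<one>\<^bsub>U\<^esub>, x) \<otimes>\<^bsub>E\<^esub> (\<one>\<^bsub>U\<^esub>, y))"
      using xy by (simp only: r_mult U.one_closed G.one_closed G.m_closed closed)
    also have "(\<one>\<^bsub>U\<^esub>, x) \<otimes>\<^bsub>E\<^esub> (\<one>\<^bsub>U\<^esub>, y) = (c x y, \<one>\<^bsub>G\<^esub>) \<otimes>\<^bsub>E\<^esub> (\<one>\<^bsub>U\<^esub>, x \<otimes>\<^bsub>G\<^esub> y)"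
      using xy by simp
    also have "?r \<dots> = ?r (c x y, \<one>\<^bsub>G\<^esub>) \<otimes>\<^bsub>?Q\<^esub> ?r (\<one>\<^bsub>U\<^esub>, x \<otimes>\<^bsub>G\<^esub> y)"
      using xy by (simp only: r_mult U.one_closed G.one_closed G.m_closed closed)
    finally have "\<phi> (bar_boundary G (frag_of xs)) = ?r (c x y, \<one>\<^bsub>G\<^esub>)"
      by (subst (asm) Q.right_cancel) (use xy \<phi>.hom_closed[OF bd] r.hom_closed in auto)
    then show "\<phi> (bar_boundary G (frag_of xs)) = ?i (frag_of xs)"
      using xy by (simp add: of_xs qc)
  qed (rule Q.is_group)
  \<comment> \<open>The unit of the quotient is the coset of the derived subgroup itself, so this
    equation expresses membership.\<close>
  then have "?r (q z, \<one>\<^bsub>G\<^esub>) = ?D"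
    using z \<phi>_zero by (simp add: bar_cycles_iff)
  moreover have "(q z, \<one>\<^bsub>G\<^esub>) \<in> carrier E"
    using z hom_in_carrier[OF q] by (simp add: bar_cycles_iff)
  ultimately show ?thesis
    using E.rcos_self[OF _ D.subgroup_axioms] by metis
qed

section \<open>Vanishing of the Bogomolov multiplier\<close>

text \<open>The cycle is supported on the abelian subgroup generated by the two elements. This is
  the half of the equivalence between the two descriptions of \<open>M_0\<close> that makes the
  later cocycle symmetric on commuting pairs.\<close>

lemma (in group) commuting_cells_in_schur_multiplier0:
  assumes "x \<in> carrier G" "y \<in> carrier G" "x \<otimes> y = y \<otimes> x"
  shows "bar_cell G [x, y] - bar_cell G [y, x] \<in> bar_cycles G 2"
    and "bar_boundaries G 2 #>\<^bsub>bar_chain_group G 2\<^esub> (bar_cell G [x, y] - bar_cell G [y, x]) \<in> schur_multiplier0 G"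
proof -
  let ?z = "bar_cell G [x, y] - bar_cell G [y, x]"
  have bd: "bar_boundary G ?z = 0"
    using assms by (simp add: bar_boundary_diff bar_boundary_cell_2)
  then show "?z \<in> bar_cycles G 2"
    using assms by (auto simp: bar_cycles_iff intro!: diff_bar_chain_group bar_cell_in_bar_chain_group)
  obtain B where B: "subgroup B G" "comm_group (G\<lparr>carrier := B\<rparr>)" "x \<in> B" "y \<in> B"
    using commuting_pair_in_abelian_subgroup[OF assms] .
  let ?H = "G\<lparr>carrier := B\<rparr>"
  interpret H: comm_group ?H by fact
  have "bar_cell ?H [x, y] - bar_cell ?H [y, x] \<in> carrier (bar_chain_group ?H 2)"
    using B by (intro diff_bar_chain_group bar_cell_in_bar_chain_group) auto
  then have z: "?z \<in> bar_cycles ?H 2"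
    using bd by (simp add: bar_cycles_iff bar_boundary_subgroup bar_cell_def)
  then have "bar_boundaries ?H 2 #>\<^bsub>bar_chain_group ?H 2\<^esub> ?z \<in> carrier (group_homology 2 ?H)"
    by (auto simp: H.carrier_group_homology)
  then show "bar_boundaries G 2 #>\<^bsub>bar_chain_group G 2\<^esub> ?z \<in> schur_multiplier0 G"
    unfolding schur_multiplier0_def using B group_homology_map_inclusion[OF B(1) z]
    by (intro generate.incl) (auto simp: image_iff intro!: exI[of _ B] bexI)
qed

lemma (in group) subgroup_schur_multiplier0:
  "subgroup (schur_multiplier0 G) (schur_multiplier G)"
proof -
  interpret M: comm_group "schur_multiplier G"
    unfolding schur_multiplier_def by (rule comm_group_group_homology_2)
  show ?thesis
    unfolding schur_multiplier0_def
  proof (rule M.generate_is_subgroup, clarify)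
    fix B C
    assume B: "subgroup B G" and C: "C \<in> carrier (group_homology 2 (G\<lparr>carrier := B\<rparr>))"
    interpret H: group "G\<lparr>carrier := B\<rparr>" using B by (rule subgroup_imp_group)
    obtain z where z: "z \<in> bar_cycles (G\<lparr>carrier := B\<rparr>) 2"
      and C_eq: "C = bar_boundaries (G\<lparr>carrier := B\<rparr>) 2 #>\<^bsub>bar_chain_group (G\<lparr>carrier := B\<rparr>) 2\<^esub> z"
      using C by (auto simp: H.carrier_group_homology)
    have "z \<in> bar_cycles G 2"
      using z carrier_bar_chain_group_mono[OF subgroup.subset[OF B]]
      by (auto simp: bar_cycles_iff bar_boundary_subgroup)
    then show "group_homology_map 2 G (\<lambda>x. x) C \<in> carrier (schur_multiplier G)"
      unfolding C_eq group_homology_map_inclusion[OF B z]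
      by (simp add: schur_multiplier_def carrier_group_homology)
  qed
qed

lemma schur_multiplier0_eq_carrier:
  assumes "abelian_by_cyclic G"
  shows "schur_multiplier0 G = carrier (schur_multiplier G)"
proof -
  interpret group G using assms by (simp add: abelian_by_cyclic_def)
  let ?C = "bar_chain_group G 2" and ?cl = "\<lambda>z. bar_boundaries G 2 #>\<^bsub>bar_chain_group G 2\<^esub> z"
  interpret C: comm_group ?C by (rule comm_group_bar_chain_group)
  interpret cl: group_hom "?C\<lparr>carrier := bar_cycles G 2\<rparr>" "schur_multiplier G" ?cl
    unfolding schur_multiplier_def by (rule group_hom_homology_class_2)
  have M0: "subgroup (schur_multiplier0 G) (schur_multiplier G)"
    by (rule subgroup_schur_multiplier0)
  define N where "N = {z \<in> bar_cycles G 2. ?cl z \<in> schur_multiplier0 G}"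
  have "subgroup N (?C\<lparr>carrier := bar_cycles G 2\<rparr>)"
  proof (rule cl.G.subgroupI)
    show "N \<noteq> {}"
      using cl.hom_one subgroup.one_closed[OF M0] cl.G.one_closed by (auto simp: N_def)
  next
    fix a b assume "a \<in> N" "b \<in> N"
    then show "a \<otimes>\<^bsub>?C\<lparr>carrier := bar_cycles G 2\<rparr>\<^esub> b \<in> N"
      using cl.hom_mult[of a b] cl.G.m_closed[of a b] subgroup.m_closed[OF M0] by (simp add: N_def)
  next
    fix a assume "a \<in> N"
    then show "inv\<^bsub>?C\<lparr>carrier := bar_cycles G 2\<rparr>\<^esub> a \<in> N"
      using cl.hom_inv[of a] cl.G.inv_closed[of a] subgroup.m_inv_closed[OF M0] by (simp add: N_def)
  qed (auto simp: N_def)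
  then have N: "subgroup N ?C"
    by (rule C.incl_subgroup[OF subgroup_bar_cycles])
  \<comment> \<open>Boundaries have trivial class, so \<open>N\<close> contains them; modulo
    \<open>N\<close> the boundary of a 3-cell becomes the cocycle identity.\<close>
  have boundary_N: "b \<in> N" if "b \<in> bar_boundaries G 2" for b
  proof -
    have "?cl b = bar_boundaries G 2"
      using C.coset_join2[of b "bar_boundaries G 2"] subgroup_bar_boundaries that
      by (metis subgroup.mem_carrier)
    also have "\<dots> = \<one>\<^bsub>schur_multiplier G\<^esub>"
      by (simp add: schur_multiplier_def group_homology_def)
    finally show ?thesis
      using that bar_boundaries_2_subset_cycles subgroup.one_closed[OF M0] by (auto simp: N_def)
  qed
  interpret N: normal N ?C using N C.normal_iff_subgroup by blast
  \<comment> \<open>The quotient is taken of all 2-chains, since a single cell \<open>[x|y]\<close>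
    need not be a cycle but must have a value.\<close>
  let ?U = "?C Mod N"
  interpret U: comm_group ?U using N by (rule C.abelian_FactGroup)
  define q where "q z = N #>\<^bsub>?C\<^esub> z" for z
  have q: "q \<in> hom ?C ?U"
    unfolding q_def using N.r_coset_hom_Mod .
  interpret q: group_hom ?C ?U q
    using q by unfold_locales
  have q_eq: "q z = q w" if "z \<in> carrier ?C" "w \<in> carrier ?C" "z - w \<in> N" for z w
    using that unfolding q_def
    by (intro C.repr_independence[OF _ _ N, symmetric]) (auto simp: r_coset_def intro!: bexI[of _ "z - w"])
  \<comment> \<open>Using \<open>bar_cell\<close> gives degenerate pairs the value
    \<open>q 0\<close>, which makes the cocycle normalized.\<close>
  define c where "c x y = q (bar_cell G [x, y])" for x y
  have cell: "bar_cell G [x, y] \<in> carrier ?C" if "x \<in> carrier G" "y \<in> carrier G" for x y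
    using that by (intro bar_cell_in_bar_chain_group) auto
  have q_zero: "q 0 = \<one>\<^bsub>?U\<^esub>"
    using q.hom_one by simp
  interpret normalized_cocycle ?U G c
  proof unfold_locales
    fix x y z assume [simp]: "x \<in> carrier G" "y \<in> carrier G" "z \<in> carrier G"
    have "bar_cell G [y, z] + bar_cell G [x, y \<otimes>\<^bsub>G\<^esub> z] - (bar_cell G [x, y] + bar_cell G [x \<otimes>\<^bsub>G\<^esub> y, z]) \<in> N"
    \<comment> \<open>If an entry is the identity, \<open>[x, y, z]\<close> is no generator of the
      3-chains, so the terms are cancelled directly. Otherwise the expression is the boundary of
      this cell, including when a product of two entries is the identity.\<close>
    proof (cases "x = \<one>\<^bsub>G\<^esub> \<or> y = \<one>\<^bsub>G\<^esub> \<or> z = \<one>\<^bsub>G\<^esub>")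
      case True
      have cell_one: "bar_cell G [\<one>\<^bsub>G\<^esub>, u] = 0" "bar_cell G [u, \<one>\<^bsub>G\<^esub>] = 0" for u
        by (simp_all add: bar_cell_def)
      show ?thesis
        using True subgroup.one_closed[OF N] by (elim disjE) (simp_all add: cell_one)
    next
      case False
      then have "\<one>\<^bsub>G\<^esub> \<notin> set [x, y, z]"
        unfolding list.set insert_iff empty_iff by metis
      then have "set [x, y, z] \<subseteq> carrier G - {\<one>\<^bsub>G\<^esub>}"
        unfolding subset_Diff_insert by simp
      then have "frag_of [x, y, z] \<in> carrier (bar_chain_group G (Suc 2))"
        by (simp only: carrier_bar_chain_group) simp
      then have "bar_boundary G (frag_of [x, y, z]) \<in> N"
        using boundary_N bar_boundaries_iff by metis
      then show ?thesis
        by (simp add: bar_boundary_frag_of_3 algebra_simps)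
    qed
    then have "q (bar_cell G [y, z] \<otimes>\<^bsub>?C\<^esub> bar_cell G [x, y \<otimes>\<^bsub>G\<^esub> z]) = q (bar_cell G [x, y] \<otimes>\<^bsub>?C\<^esub> bar_cell G [x \<otimes>\<^bsub>G\<^esub> y, z])"
      by (intro q_eq C.m_closed cell) auto
    then show "c x y \<otimes>\<^bsub>?U\<^esub> c (x \<otimes>\<^bsub>G\<^esub> y) z = c y z \<otimes>\<^bsub>?U\<^esub> c x (y \<otimes>\<^bsub>G\<^esub> z)"
      by (simp only: c_def q.hom_mult cell m_closed \<open>x \<in> carrier G\<close> \<open>y \<in> carrier G\<close> \<open>z \<in> carrier G\<close>)
  qed (simp_all only: c_def q.hom_closed cell, simp_all add: bar_cell_def q_zero)
  have sym: "c x y = c y x" if "x \<in> carrier G" "y \<in> carrier G" "x \<otimes>\<^bsub>G\<^esub> y = y \<otimes>\<^bsub>G\<^esub> x" for x y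
    unfolding c_def using commuting_cells_in_schur_multiplier0[OF that] that
    by (intro q_eq cell) (auto simp: N_def)
  have "bar_cycles G 2 \<subseteq> N"
  proof
    fix z assume z: "z \<in> bar_cycles G 2"
    \<comment> \<open>The cycle gives an element of the derived subgroup lying over the identity of
      \<open>G\<close>, which must be trivial; so the coset of \<open>z\<close> is
      \<open>N\<close>.\<close>
    have "q z = \<one>\<^bsub>?U\<^esub>"
      using cycle_in_derived[OF q _ z] by (intro trivial_of_derived[OF assms sym]) (auto simp: c_def)
    then show "z \<in> N"
      using z C.rcos_self[OF _ N, of z] by (simp add: q_def bar_cycles_iff)
  qed
  then have "carrier (schur_multiplier G) \<subseteq> schur_multiplier0 G"
    by (auto simp: schur_multiplier_def carrier_group_homology N_def)
  then show ?thesis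
    using subgroup.subset[OF M0] by blast
qed

theorem theorem6p2:
  fixes G :: "('a, 'b) monoid_scheme"
  assumes "abelian_by_cyclic G"
  shows "trivial_group (bogomolov_multiplier G)"
proof -
  interpret group G using assms by (simp add: abelian_by_cyclic_def)
  interpret M: comm_group "schur_multiplier G"
    unfolding schur_multiplier_def by (rule comm_group_group_homology_2)
  interpret normal "carrier (schur_multiplier G)" "schur_multiplier G"
    by (rule M.normal_self)
  \<comment> \<open>The multiplier is now the quotient of \<open>M(G)\<close> by itself, whose only
    coset is the whole group.\<close>
  have "carrier (bogomolov_multiplier G) \<subseteq> {\<one>\<^bsub>bogomolov_multiplier G\<^esub>}"
    unfolding bogomolov_multiplier_def schur_multiplier0_eq_carrier[OF assms]
    using M.coset_join2[OF _ M.subgroup_self] by (auto simp: carrier_FactGroup)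
  then show ?thesis
    using factorgroup_is_group group.trivial_group_subset
    unfolding bogomolov_multiplier_def schur_multiplier0_eq_carrier[OF assms] by blast
qed

end
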